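(* Let $q,a,b,c,b',c'$ be nonzero complex numbers with $|q|<1$, such that no denominator appearing below vanishes. Let $(\alpha_m)_{m\ge0}$ and $(\beta_{(n,l)})_{n,l\ge0}$ be complex sequences such that for all $n,l\ge0$ $$\beta_{(n,l)}=\sum_{m=0}^{\min(n,l)}\frac{\alpha_m}{(q;q)_{n-m}(q;q)_{l-m}(aq;q)_{n+m}(aq;q)_{l+m}}.$$ Define, for $m\geq 0$, $$\alpha'_m=\frac{(b,c,b',c';q)_m}{(qa/b,\,qa/c,\,qa/b',\,qa/c';q)_m}\left(\frac{a^2q^2}{bcb'c'}\right)^m\alpha_m,$$ and, for $M,N\ge0$, $$\beta'_{(M,N)}=\sum_{n=0}^{M}\sum_{l=0}^{N}\frac{(b,c;q)_n\,(qa/(bc);q)_{M-n}\left(\frac{qa}{bc}\right)^n}{(qa/b,\,qa/c;q)_M\,(q;q)_{M-n}}\cdot\frac{(b',c';q)_l\,(qa/(b'c');q)_{N-l}\left(\frac{qa}{b'c'}\right)^l}{(qa/b',\,qa/c';q)_N\,(q;q)_{N-l}}\;\beta_{(n,l)}.$$ Then for all $n,l\ge0$ $$\beta'_{(n,l)}=\sum_{m=0}^{\min(n,l)}\frac{\alpha'_m}{(q;q)_{n-m}(q;q)_{l-m}(aq;q)_{n+m}(aq;q)_{l+m}}.$$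
   Context: Notation: $(x;q)_n=\prod_{j=0}^{n-1}(1-xq^j)$ for integers $n\ge0$, and $(x_1,\dots,x_r;q)_n=\prod_{i}(x_i;q)_n$. *)

theory Defs
  imports Complex_Main
begin

definition qpoch :: "complex \<Rightarrow> complex \<Rightarrow> nat \<Rightarrow> complex" where
  "qpoch x q n = (\<Prod>j<n. 1 - x * q ^ j)"

(* qpochs [x1, ..., xr] q n is (x1, ..., xr; q)_n. *)
definition qpochs :: "complex list \<Rightarrow> complex \<Rightarrow> nat \<Rightarrow> complex" where
  "qpochs xs q n = (\<Prod>x\<leftarrow>xs. qpoch x q n)"

end

theory Submission
  imports Defs
begin

text \<open>
  The kernel of the hypothesis, \<open>1 / ((q;q)\<^sub>n\<^sub>-\<^sub>m (aq;q)\<^sub>n\<^sub>+\<^sub>m)\<close>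
  times the same factor in \<open>l\<close>, is a product, and so is the kernel of the transformation
  from \<open>\<beta>\<close> to \<open>\<beta>'\<close>. Interchanging the summations therefore leaves two independent
  one-dimensional sums, each evaluated by the \<open>q\<close>-Pfaff--Saalschuetz formula. The latter
  follows by induction on the length of the sum, because its terms satisfy a two-term recurrence.
\<close>

lemma qpoch_0 [simp]: "qpoch x q 0 = 1"
  by (simp add: qpoch_def)

lemma qpoch_Suc: "qpoch x q (Suc n) = qpoch x q n * (1 - x * q ^ n)"
  by (simp add: qpoch_def)

lemma qpoch_add: "qpoch x q (m + n) = qpoch x q m * qpoch (x * q ^ m) q n"
  by (induction n) (simp_all add: qpoch_Suc power_add mult_ac)

lemma qpochs_2: "qpochs [x, y] q n = qpoch x q n * qpoch y q n"
  by (simp add: qpochs_def)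

lemma qpochs_4: "qpochs [x, y, z, w] q n = qpochs [x, y] q n * qpochs [z, w] q n"
  by (simp add: qpochs_def)

text \<open>
  The \<open>q\<close>-Pfaff--Saalschuetz sum is usually stated with argument \<open>q\<close>; here the factor
  \<open>(q\<^sup>-\<^sup>K;q)\<^sub>k\<close> and the fourth parameter have been rewritten by reversal, and
  the lower parameter is \<open>A = t B C\<close>.
\<close>

lemma q_saalschuetz:
  fixes q t B C :: complex
  defines "A \<equiv> t * B * C"
  assumes q: "\<And>k. qpoch q q k \<noteq> 0" and A: "\<And>k. qpoch A q k \<noteq> 0"
  shows "(\<Sum>k\<le>K. qpoch B q k * qpoch C q k * qpoch t q (K - k) * t ^ k
            / (qpoch q q k * qpoch q q (K - k) * qpoch A q k))
         = qpoch (t * B) q K * qpoch (t * C) q K / (qpoch q q K * qpoch A q K)"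
proof (induction K)
  case 0
  show ?case by simp
next
  case (Suc K)
  define T where "T K k = qpoch B q k * qpoch C q k * qpoch t q (K - k) * t ^ k
            / (qpoch q q k * qpoch q q (K - k) * qpoch A q k)" for K k
  \<comment> \<open>The weights of \<open>U\<close> and \<open>V\<close> add up to
    \<open>(1 - q ^ Suc K) * (1 - A * q ^ K)\<close>, free of \<open>k\<close>. Each cancels factors
    of \<open>T (Suc K) k\<close>, so that \<open>U k\<close> and \<open>V (Suc k)\<close> are both
    multiples of \<open>T K k\<close>. The truncated \<open>k - 1\<close> is harmless at
    \<open>k = 0\<close>, where \<open>1 - q ^ k\<close> vanishes.\<close>
  define U where "U k = T (Suc K) k * (1 - q ^ (Suc K - k)) * (1 - A * q ^ (K + k))" for k
  define V where "V k = T (Suc K) k * (1 - q ^ k) * (1 - A * q ^ (k - 1)) * q ^ (Suc K - k)" for k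
  have q1: "1 - q * q ^ k \<noteq> 0" and A1: "1 - A * q ^ k \<noteq> 0" for k
    using q[of "Suc k"] A[of "Suc k"] by (simp_all add: qpoch_Suc)
  have split: "(1 - q ^ Suc K) * (1 - A * q ^ K) * T (Suc K) k = U k + V k"
    if "k \<le> Suc K" for k
  proof (cases k)
    case 0
    then show ?thesis by (simp add: U_def V_def)
  next
    case (Suc j)
    with that obtain i where i: "K = j + i"
      using le_Suc_ex by auto
    have "(1 - q ^ Suc K) * (1 - A * q ^ K) = (1 - q ^ (Suc K - k)) * (1 - A * q ^ (K + k))
        + (1 - q ^ k) * (1 - A * q ^ (k - 1)) * q ^ (Suc K - k)"
      by (simp add: Suc i power_add algebra_simps)
    moreover have "U k + V k = ((1 - q ^ (Suc K - k)) * (1 - A * q ^ (K + k))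
        + (1 - q ^ k) * (1 - A * q ^ (k - 1)) * q ^ (Suc K - k)) * T (Suc K) k"
      unfolding U_def V_def distrib_right by (simp only: mult_ac)
    ultimately show ?thesis
      by metis
  qed
  have UV: "U k + V (Suc k) = (1 - t * B * q ^ K) * (1 - t * C * q ^ K) * T K k"
    if k: "k \<le> K" for k
  proof -
    obtain i where i: "K = k + i"
      using k le_Suc_ex by blast
    have U: "U k = T K k * (1 - t * q ^ i) * (1 - A * q ^ (K + k))"
      using q1[of i] by (simp add: U_def T_def i Suc_diff_le qpoch_Suc mult_ac)
    have V: "V (Suc k) = T K k * (1 - B * q ^ k) * (1 - C * q ^ k) * t * q ^ i"
      using q1[of k] A1[of k] by (simp add: V_def T_def i qpoch_Suc mult_ac)
    \<comment> \<open>Here the balancing condition \<open>A = t * B * C\<close> enters: it cancels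
      the terms in \<open>q ^ (2 * k + i)\<close>, leaving a factor that depends on \<open>K\<close>
      only.\<close>
    have "(1 - t * q ^ i) * (1 - A * q ^ (K + k)) + (1 - B * q ^ k) * (1 - C * q ^ k) * t * q ^ i
        = (1 - t * B * q ^ K) * (1 - t * C * q ^ K)"
      by (simp add: A_def i power_add algebra_simps)
    moreover have "U k + V (Suc k) = ((1 - t * q ^ i) * (1 - A * q ^ (K + k))
        + (1 - B * q ^ k) * (1 - C * q ^ k) * t * q ^ i) * T K k"
      unfolding U V distrib_right by (simp only: mult_ac)
    ultimately show ?thesis
      by metis
  qed
  have "(1 - q ^ Suc K) * (1 - A * q ^ K) * (\<Sum>k\<le>Suc K. T (Suc K) k)
      = (\<Sum>k\<le>Suc K. U k) + (\<Sum>k\<le>Suc K. V k)"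
    unfolding sum_distrib_left sum.distrib[symmetric] using split by (intro sum.cong) auto
  \<comment> \<open>The boundary terms \<open>U (Suc K)\<close> and \<open>V 0\<close> vanish, so
    after a shift of \<open>V\<close> both sums run over \<open>k \<le> K\<close>.\<close>
  also have "(\<Sum>k\<le>Suc K. U k) = (\<Sum>k\<le>K. U k)"
    by (simp add: U_def)
  also have "(\<Sum>k\<le>Suc K. V k) = (\<Sum>k\<le>K. V (Suc k))"
    by (subst sum.atMost_Suc_shift) (simp add: V_def)
  also have "(\<Sum>k\<le>K. U k) + (\<Sum>k\<le>K. V (Suc k))
      = (1 - t * B * q ^ K) * (1 - t * C * q ^ K) * (\<Sum>k\<le>K. T K k)"
    unfolding sum_distrib_left sum.distrib[symmetric] using UV by (intro sum.cong) auto
  also have "(\<Sum>k\<le>K. T K k)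
      = qpoch (t * B) q K * qpoch (t * C) q K / (qpoch q q K * qpoch A q K)"
    using Suc.IH by (simp add: T_def)
  finally have "(\<Sum>k\<le>Suc K. T (Suc K) k)
      = (1 - t * B * q ^ K) * (1 - t * C * q ^ K)
        * (qpoch (t * B) q K * qpoch (t * C) q K / (qpoch q q K * qpoch A q K))
        / ((1 - q ^ Suc K) * (1 - A * q ^ K))"
    using q1[of K] A1[of K] by (subst nonzero_eq_divide_eq) (auto simp: mult_ac)
  then show ?case
    by (simp add: T_def qpoch_Suc mult_ac)
qed

text \<open>The one-variable kernel of a Bailey pair. The explicit zero above the diagonal matters
  because \<open>n - m\<close> truncates; it lets sums over \<open>m\<close> have a common upper
  limit.\<close>

definition bailey_matrix :: "complex \<Rightarrow> complex \<Rightarrow> nat \<Rightarrow> nat \<Rightarrow> complex" where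
  "bailey_matrix a q n m =
    (if m \<le> n then 1 / (qpoch q q (n - m) * qpoch (a * q) q (n + m)) else 0)"

definition bailey_weight ::
    "complex \<Rightarrow> complex \<Rightarrow> complex \<Rightarrow> complex \<Rightarrow> nat \<Rightarrow> nat \<Rightarrow> complex" where
  "bailey_weight a q b c M n =
    qpochs [b, c] q n * qpoch (q * a / (b * c)) q (M - n) * (q * a / (b * c)) ^ n
      / (qpochs [q * a / b, q * a / c] q M * qpoch q q (M - n))"

text \<open>Bailey's lemma in one variable: the weights act on the kernel as a diagonal rescaling of
  its columns. Terms with \<open>n < m\<close> vanish, and \<open>n = m + k\<close> turns the rest
  into a \<open>q\<close>-Pfaff--Saalschuetz sum with \<open>b\<close> and \<open>c\<close> shifted
  by \<open>q ^ m\<close>.\<close>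

lemma bailey_weight_matrix:
  assumes b: "b \<noteq> 0" and c: "c \<noteq> 0"
    and q: "\<And>k. qpoch q q k \<noteq> 0" and a: "\<And>k. qpoch (a * q) q k \<noteq> 0"
    and qab: "\<And>k. qpoch (q * a / b) q k \<noteq> 0" and qac: "\<And>k. qpoch (q * a / c) q k \<noteq> 0"
  shows "(\<Sum>n = 0..M. bailey_weight a q b c M n * bailey_matrix a q n m)
    = qpochs [b, c] q m / qpochs [q * a / b, q * a / c] q m * (q * a / (b * c)) ^ m
      * bailey_matrix a q M m"
proof (cases "m \<le> M")
  case False
  then show ?thesis
    by (auto simp: bailey_matrix_def intro!: sum.neutral)
next
  case True
  then obtain K where K: "M = m + K"
    using le_Suc_ex by blast
  define t where "t = q * a / (b * c)"
  define B where "B = b * q ^ m"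
  define C where "C = c * q ^ m"
  define A where "A = t * B * C"
  define D where "D = qpochs [q * a / b, q * a / c] q M * qpoch (a * q) q (2 * m)"
  define S where "S k = qpoch B q k * qpoch C q k * qpoch t q (K - k) * t ^ k
            / (qpoch q q k * qpoch q q (K - k) * qpoch A q k)" for k
  \<comment> \<open>This value is exactly the parameter left when
    \<open>qpoch (a * q) q (2 * m)\<close> is split off \<open>qpoch (a * q) q (2 * m + k)\<close>,
    so the sum is balanced.\<close>
  have A_eq: "A = a * q * q ^ (2 * m)"
    using b c by (simp add: A_def B_def C_def t_def mult_2 power_add)
  have tB: "t * B = q * a / c * q ^ m" and tC: "t * C = q * a / b * q ^ m"
    using b c by (simp_all add: t_def B_def C_def)
  have aq: "qpoch (a * q) q (2 * m + k) = qpoch (a * q) q (2 * m) * qpoch A q k" for k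
    by (simp add: qpoch_add A_eq)
  have A: "qpoch A q k \<noteq> 0" for k
    using a[of "2 * m + k"] aq by simp
  have "(\<Sum>n = 0..M. bailey_weight a q b c M n * bailey_matrix a q n m)
      = (\<Sum>n = 0 + m..K + m. bailey_weight a q b c M n * bailey_matrix a q n m)"
    by (intro sum.mono_neutral_right) (auto simp: K bailey_matrix_def)
  also have "\<dots> = (\<Sum>k\<le>K. bailey_weight a q b c M (k + m) * bailey_matrix a q (k + m) m)"
    by (simp only: sum.shift_bounds_cl_nat_ivl atMost_atLeast0)
  also have "\<dots> = (\<Sum>k\<le>K. qpochs [b, c] q m * t ^ m / D * S k)"
  proof (intro sum.cong refl)
    fix k assume "k \<in> {..K}"
    have 1: "k + m + m = 2 * m + k" "M - (k + m) = K - k"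
      by (simp_all add: K)
    have 2: "qpochs [b, c] q (k + m) = qpochs [b, c] q m * qpoch B q k * qpoch C q k"
      by (simp add: qpochs_2 B_def C_def add.commute[of k] qpoch_add)
    show "bailey_weight a q b c M (k + m) * bailey_matrix a q (k + m) m
        = qpochs [b, c] q m * t ^ m / D * S k"
      unfolding bailey_weight_def bailey_matrix_def 1 2 t_def[symmetric] aq
      by (simp add: S_def D_def power_add mult_ac)
  qed
  also have "\<dots> = qpochs [b, c] q m * t ^ m / D * (\<Sum>k\<le>K. S k)"
    by (simp add: sum_distrib_left)
  also have "(\<Sum>k\<le>K. S k)
      = qpoch (t * B) q K * qpoch (t * C) q K / (qpoch q q K * qpoch A q K)"
    unfolding S_def A_def by (rule q_saalschuetz) (use q A in \<open>simp_all add: A_def\<close>)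
  also have "qpochs [b, c] q m * t ^ m / D * \<dots>
      = qpochs [b, c] q m / qpochs [q * a / b, q * a / c] q m * t ^ m * bailey_matrix a q M m"
  proof -
    \<comment> \<open>The numerator of the evaluated sum is the tail of this product beyond
      \<open>m\<close>, hence it cancels against \<open>D\<close>; \<open>t * B\<close> belongs to
      \<open>c\<close> and \<open>t * C\<close> to \<open>b\<close>.\<close>
    have "qpochs [q * a / b, q * a / c] q M
        = qpochs [q * a / b, q * a / c] q m * (qpoch (t * B) q K * qpoch (t * C) q K)"
      unfolding K qpochs_2 qpoch_add tB tC by (simp add: mult_ac)
    moreover have "qpoch (t * B) q K * qpoch (t * C) q K \<noteq> 0"
      using qab[of "m + K"] qac[of "m + K"] unfolding qpoch_add tB tC by simp
    moreover have "bailey_matrix a q M m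
        = 1 / (qpoch q q K * (qpoch (a * q) q (2 * m) * qpoch A q K))"
      using aq[of K] by (simp add: bailey_matrix_def K mult_2 add_ac)
    ultimately show ?thesis
      by (simp add: D_def mult_ac)
  qed
  finally show ?thesis
    by (simp only: t_def)
qed

text \<open>Beyond \<open>min n l\<close> one of the two kernels is zero. This frees the upper limit
  from \<open>n\<close> and \<open>l\<close>, as interchanging the summations requires.\<close>

lemma sum_bailey_matrix_prod:
  assumes "min n l \<le> P"
  shows "(\<Sum>m = 0..min n l. \<alpha> m /
        (qpoch q q (n - m) * qpoch q q (l - m) * qpoch (a * q) q (n + m) * qpoch (a * q) q (l + m)))
    = (\<Sum>m = 0..P. \<alpha> m * bailey_matrix a q n m * bailey_matrix a q l m)"
  by (rule sum.mono_neutral_cong_left) (use assms in \<open>auto simp: bailey_matrix_def mult_ac\<close>)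

theorem theorem4p1:
  fixes q a b c b' c' :: complex
    and \<alpha> \<alpha>' :: "nat \<Rightarrow> complex"
    and \<beta> \<beta>' :: "nat \<Rightarrow> nat \<Rightarrow> complex"
  assumes nonzero: "q \<noteq> 0" "a \<noteq> 0" "b \<noteq> 0" "c \<noteq> 0" "b' \<noteq> 0" "c' \<noteq> 0"
    and norm_q: "norm q < 1"
    and denominators:
      "\<And>k. qpoch q q k \<noteq> 0"
      "\<And>k. qpoch (a * q) q k \<noteq> 0"
      "\<And>k. qpoch (q * a / b) q k \<noteq> 0"
      "\<And>k. qpoch (q * a / c) q k \<noteq> 0"
      "\<And>k. qpoch (q * a / b') q k \<noteq> 0"
      "\<And>k. qpoch (q * a / c') q k \<noteq> 0"
    and beta: "\<And>n l. \<beta> n l =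
      (\<Sum>m = 0..min n l. \<alpha> m /
        (qpoch q q (n - m) * qpoch q q (l - m) * qpoch (a * q) q (n + m) * qpoch (a * q) q (l + m)))"
    and alpha': "\<And>m. \<alpha>' m =
      qpochs [b, c, b', c'] q m / qpochs [q * a / b, q * a / c, q * a / b', q * a / c'] q m
        * (a\<^sup>2 * q\<^sup>2 / (b * c * b' * c')) ^ m * \<alpha> m"
    and beta': "\<And>M N. \<beta>' M N =
      (\<Sum>n = 0..M. \<Sum>l = 0..N.
        (qpochs [b, c] q n * qpoch (q * a / (b * c)) q (M - n) * (q * a / (b * c)) ^ n
          / (qpochs [q * a / b, q * a / c] q M * qpoch q q (M - n)))
        * (qpochs [b', c'] q l * qpoch (q * a / (b' * c')) q (N - l) * (q * a / (b' * c')) ^ l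
          / (qpochs [q * a / b', q * a / c'] q N * qpoch q q (N - l)))
        * \<beta> n l)"
  shows "\<forall>n l. \<beta>' n l =
      (\<Sum>m = 0..min n l. \<alpha>' m /
        (qpoch q q (n - m) * qpoch q q (l - m) * qpoch (a * q) q (n + m) * qpoch (a * q) q (l + m)))"
proof (intro allI)
  fix M N :: nat
  let ?w = "bailey_weight a q b c M" and ?w' = "bailey_weight a q b' c' N"
  let ?K = "bailey_matrix a q"
  let ?r = "\<lambda>b c m. qpochs [b, c] q m / qpochs [q * a / b, q * a / c] q m * (q * a / (b * c)) ^ m"
  have "\<beta>' M N = (\<Sum>n = 0..M. \<Sum>l = 0..N. ?w n * ?w' l * \<beta> n l)"
    unfolding beta' bailey_weight_def ..
  also have "\<dots> = (\<Sum>n = 0..M. \<Sum>l = 0..N. \<Sum>m = 0..min M N.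
      \<alpha> m * (?w n * ?K n m) * (?w' l * ?K l m))"
  proof (intro sum.cong refl)
    fix n l assume "n \<in> {0..M}" "l \<in> {0..N}"
    then have "\<beta> n l = (\<Sum>m = 0..min M N. \<alpha> m * ?K n m * ?K l m)"
      unfolding beta by (intro sum_bailey_matrix_prod) auto
    then show "?w n * ?w' l * \<beta> n l
        = (\<Sum>m = 0..min M N. \<alpha> m * (?w n * ?K n m) * (?w' l * ?K l m))"
      by (simp add: sum_distrib_left mult_ac)
  qed
  also have "\<dots> = (\<Sum>n = 0..M. \<Sum>m = 0..min M N. \<Sum>l = 0..N.
      \<alpha> m * (?w n * ?K n m) * (?w' l * ?K l m))"
    by (intro sum.cong refl sum.swap)
  also have "\<dots> = (\<Sum>m = 0..min M N. \<Sum>n = 0..M. \<Sum>l = 0..N.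
      \<alpha> m * (?w n * ?K n m) * (?w' l * ?K l m))"
    by (rule sum.swap)
  \<comment> \<open>For fixed \<open>m\<close> the summand is a function of \<open>n\<close> times a
    function of \<open>l\<close>, so the double sum is a product of two sums covered by
    \<open>bailey_weight_matrix\<close>.\<close>
  also have "\<dots> = (\<Sum>m = 0..min M N.
      \<alpha> m * (\<Sum>n = 0..M. ?w n * ?K n m) * (\<Sum>l = 0..N. ?w' l * ?K l m))"
    unfolding mult.assoc[of "\<alpha> _"] sum_product unfolding sum_distrib_left ..
  also have "\<dots> = (\<Sum>m = 0..min M N.
      \<alpha> m * (?r b c m * ?K M m) * (?r b' c' m * ?K N m))"
    using nonzero denominators by (simp only: bailey_weight_matrix not_False_eq_True)
  also have "\<dots> = (\<Sum>m = 0..min M N. \<alpha>' m * ?K M m * ?K N m)"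
  proof (intro sum.cong refl)
    fix m
    \<comment> \<open>The argument of \<open>\<alpha>'\<close> is the product of the two
      one-variable arguments.\<close>
    have "(a\<^sup>2 * q\<^sup>2 / (b * c * b' * c')) ^ m
        = (q * a / (b * c)) ^ m * (q * a / (b' * c')) ^ m"
      by (simp add: power_mult_distrib[symmetric] power2_eq_square mult_ac)
    then have "\<alpha>' m = \<alpha> m * ?r b c m * ?r b' c' m"
      unfolding alpha' qpochs_4 by (simp add: mult_ac)
    then show "\<alpha> m * (?r b c m * ?K M m) * (?r b' c' m * ?K N m) = \<alpha>' m * ?K M m * ?K N m"
      by (simp only: mult_ac)
  qed
  also have "\<dots> = (\<Sum>m = 0..min M N. \<alpha>' m /
      (qpoch q q (M - m) * qpoch q q (N - m) * qpoch (a * q) q (M + m) * qpoch (a * q) q (N + m)))"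
    by (rule sum_bailey_matrix_prod[symmetric]) simp
  finally show "\<beta>' M N = \<dots>" .
qed

end
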